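(* There is an absolute constant $c>0$, and for all $C_1,C_2>0$ there is a constant $C>0$ depending only on $C_1,C_2$ (in particular independent of $\varepsilon_2$ and $\varepsilon_\infty$), such that the following holds. Let $\Phi$ be an $L^2(D)$-normalized eigenfunction of $\mathcal K_{\mathrm{diag}}^{(0)}$ associated with a simple isolated eigenvalue $\rho$, assume $\varepsilon_2\le c\,d_\rho$, let $(\rho_\kappa,\Phi_\kappa)=(\rho+\delta\rho,\Phi+\delta\phi)$ be a corresponding coupled eigenpair of $\mathcal K_D^{(0)}$ with constant $C_1$ (in the sense defined in the context), and assume $|\delta\rho|/|\rho|\le\frac12$. Assume in addition that $$|\delta\rho|\le C_2\frac{\varepsilon_2^2}{d_\rho}.$$ Then $$\|\delta\phi\|_{C^0(\overline D)}\le C\left(\frac{C_0}{|\rho|}\frac{\varepsilon_2}{d_\rho}+\frac{\varepsilon_\infty}{|\rho|}+\frac{\varepsilon_\infty}{|\rho|}\frac{\varepsilon_2}{d_\rho}+\frac{C_0}{|\rho|^2}\frac{\varepsilon_2^2}{d_\rho}\right).$$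
   Context: Setting. $D_1,D_2\subset\mathbb R^3$ are bounded domains whose distance is $\kappa=\operatorname{dist}(D_1,D_2)>0$, and $D=D_1\cup D_2$. The static Newtonian operator on $L^2(D)$ is $$\mathcal K_D^{(0)}[u](x)=-\frac1{4\pi}\int_D\frac{u(y)}{|x-y|}\,dy .$$ With respect to $L^2(D)=L^2(D_1)\oplus L^2(D_2)$, let $\mathcal K_{ij}^{(0)}:L^2(D_j)\to L^2(D_i)$ be $\mathcal K_{ij}^{(0)}[u](x)=-\frac1{4\pi}\int_{D_j}\frac{u(y)}{|x-y|}\,dy$ for $x\in D_i$, and write $\mathcal K_D^{(0)}=\mathcal K_{\mathrm{diag}}^{(0)}+\mathcal K_{\mathrm{off}}^{(0)}$ with $$\mathcal K_{\mathrm{diag}}^{(0)}=\begin{pmatrix}\mathcal K_{11}^{(0)}&0\\0&\mathcal K_{22}^{(0)}\end{pmatrix},\qquad \mathcal K_{\mathrm{off}}^{(0)}=\begin{pmatrix}0&\mathcal K_{12}^{(0)}\\\mathcal K_{21}^{(0)}&0\end{pmatrix}.$$ These operators map $L^2(D)$ continuously into $C^0(\overline D)$; in particular eigenfunctions are identified with their continuous representatives on $\overline D$. Quantities. $d_\rho=\operatorname{dist}(\rho,\operatorname{sp}(\mathcal K_{\mathrm{diag}}^{(0)})\setminus\{\rho\})>0$, $\varepsilon_2=\|\mathcal K_{\mathrm{off}}^{(0)}\|_{L^2\to L^2}$, $\varepsilon_\infty=\|\mathcal K_{\mathrm{off}}^{(0)}\|_{L^2\to C^0}$, $C_0=\|\mathcal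 K_{\mathrm{diag}}^{(0)}\|_{L^2\to C^0}$, where $L^2=L^2(D)$ and $C^0=C^0(\overline D)$. Corresponding coupled eigenpair with constant $C_1$. An eigenpair $(\rho_\kappa,\Phi_\kappa)$ of $\mathcal K_D^{(0)}$ with $\|\Phi_\kappa\|_{L^2(D)}=1$ and $\langle\Phi_\kappa,\Phi\rangle_{L^2(D)}\in\mathbb R_{>0}$ such that, with $\delta\phi=\Phi_\kappa-\Phi$ and $\delta\rho=\rho_\kappa-\rho$: $$\|\delta\phi\|_{L^2}\le C_1\frac{\varepsilon_2}{d_\rho},\qquad \|\delta\phi+S_\rho\mathcal K_{\mathrm{off}}^{(0)}\Phi\|_{L^2}\le C_1\frac{\varepsilon_2^2}{d_\rho^2},\qquad |\delta\rho-\langle\mathcal K_{\mathrm{off}}^{(0)}\Phi,\Phi\rangle_{L^2}|\le C_1\frac{\varepsilon_2^2}{d_\rho},$$ where $S_\rho=Q_\rho(\mathcal K_{\mathrm{diag}}^{(0)}-\rho I)^{-1}Q_\rho$, $Q_\rho=I-P_\rho$, and $P_\rho$ is the orthogonal projection onto $\operatorname{span}\{\Phi\}$. *)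

theory Defs
  imports "HOL-Analysis.Analysis"
begin

type_synonym field = "real^3 \<Rightarrow> complex"

definition bounded_domain :: "(real^3) set \<Rightarrow> bool" where
  "bounded_domain D \<longleftrightarrow> open D \<and> connected D \<and> D \<noteq> {} \<and> bounded D"


text \<open>
  The space \<open>L\<^sup>2(D)\<close> is represented by functions on the whole space, of which only the values
  on \<open>D\<close> matter; equality in \<open>L\<^sup>2(D)\<close> is \<open>l2_eq D\<close>. Operators act on representatives.
\<close>

definition l2_space :: "(real^3) set \<Rightarrow> field set" where
  "l2_space D = {u. u \<in> borel_measurable (lebesgue_on D) \<and>
                    integrable (lebesgue_on D) (\<lambda>x. (norm (u x))\<^sup>2)}"

definition l2_eq :: "(real^3) set \<Rightarrow> field \<Rightarrow> field \<Rightarrow> bool" where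
  "l2_eq D u v \<longleftrightarrow> (AE x in lebesgue_on D. u x = v x)"

definition l2_inner :: "(real^3) set \<Rightarrow> field \<Rightarrow> field \<Rightarrow> complex" where
  "l2_inner D u v = (LINT x|lebesgue_on D. u x * cnj (v x))"

definition l2_norm :: "(real^3) set \<Rightarrow> field \<Rightarrow> real" where
  "l2_norm D u = sqrt (LINT x|lebesgue_on D. (norm (u x))\<^sup>2)"

definition sup_norm :: "(real^3) set \<Rightarrow> field \<Rightarrow> real" where
  "sup_norm S u = (SUP x\<in>S. norm (u x))"

text \<open>
  The operator norms \<open>L\<^sup>2(D) \<rightarrow> L\<^sup>2(D)\<close> and \<open>L\<^sup>2(D) \<rightarrow> C\<^sup>0(closure D)\<close>. As real suprema they are
  meaningful for bounded operators, which all operators below are when \<open>D\<close> is bounded.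
\<close>

definition opnorm_l2_l2 :: "(real^3) set \<Rightarrow> (field \<Rightarrow> field) \<Rightarrow> real" where
  "opnorm_l2_l2 D T = (SUP u\<in>{u \<in> l2_space D. l2_norm D u \<le> 1}. l2_norm D (T u))"

definition opnorm_l2_C0 :: "(real^3) set \<Rightarrow> (field \<Rightarrow> field) \<Rightarrow> real" where
  "opnorm_l2_C0 D T = (SUP u\<in>{u \<in> l2_space D. l2_norm D u \<le> 1}. sup_norm (closure D) (T u))"

definition bounded_l2_operator :: "(real^3) set \<Rightarrow> (field \<Rightarrow> field) \<Rightarrow> bool" where
  "bounded_l2_operator D T \<longleftrightarrow>
     (\<forall>u\<in>l2_space D. T u \<in> l2_space D) \<and>
     (\<forall>u\<in>l2_space D. \<forall>v\<in>l2_space D. l2_eq D (T (\<lambda>x. u x + v x)) (\<lambda>x. T u x + T v x)) \<and>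
     (\<forall>u\<in>l2_space D. \<forall>a. l2_eq D (T (\<lambda>x. a * u x)) (\<lambda>x. a * T u x)) \<and>
     (\<exists>M. \<forall>u\<in>l2_space D. l2_norm D (T u) \<le> M * l2_norm D u)"

definition l2_resolvent_set :: "(real^3) set \<Rightarrow> (field \<Rightarrow> field) \<Rightarrow> complex set" where
  "l2_resolvent_set D T = {\<mu>. \<exists>R. bounded_l2_operator D R \<and>
     (\<forall>u\<in>l2_space D. l2_eq D (R (\<lambda>x. T u x - \<mu> * u x)) u \<and>
                      l2_eq D (\<lambda>x. T (R u) x - \<mu> * R u x) u)}"

definition l2_spectrum :: "(real^3) set \<Rightarrow> (field \<Rightarrow> field) \<Rightarrow> complex set" where
  "l2_spectrum D T = - l2_resolvent_set D T"

text \<open>An eigenfunction is given by its continuous representative on the closure.\<close>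

definition eigenfunction ::
    "(real^3) set \<Rightarrow> (field \<Rightarrow> field) \<Rightarrow> complex \<Rightarrow> field \<Rightarrow> bool" where
  "eigenfunction D T \<mu> u \<longleftrightarrow>
     u \<in> l2_space D \<and> \<not> l2_eq D u (\<lambda>x. 0) \<and> continuous_on (closure D) u \<and>
     l2_eq D (T u) (\<lambda>x. \<mu> * u x)"

text \<open>
  Simplicity means that the eigenspace in \<open>L\<^sup>2(D)\<close> is one-dimensional; for the self-adjoint
  operators considered here, geometric and algebraic multiplicity agree.
\<close>

definition simple_eigenvalue :: "(real^3) set \<Rightarrow> (field \<Rightarrow> field) \<Rightarrow> complex \<Rightarrow> bool" where
  "simple_eigenvalue D T \<mu> \<longleftrightarrow>
     (\<exists>e\<in>l2_space D. \<not> l2_eq D e (\<lambda>x. 0) \<and>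
        (\<forall>u\<in>l2_space D. l2_eq D (T u) (\<lambda>x. \<mu> * u x) \<longleftrightarrow> (\<exists>a. l2_eq D u (\<lambda>x. a * e x))))"


text \<open>
  At \<open>y = x\<close> the kernel takes the value 0 because of \<open>1 / 0 = 0\<close>; this is a null set.
\<close>

definition newton :: "(real^3) set \<Rightarrow> field \<Rightarrow> field" where
  "newton D u x = - (1 / (4 * pi)) *\<^sub>R (LINT y|lebesgue_on D. u y / of_real (dist x y))"

definition K_full :: "(real^3) set \<Rightarrow> (real^3) set \<Rightarrow> field \<Rightarrow> field" where
  "K_full D1 D2 = newton (D1 \<union> D2)"

text \<open>
  The block operators, for \<open>D1\<close> and \<open>D2\<close> at positive distance: on the closure of \<open>Di\<close> the
  (i,j) block is \<open>newton Dj\<close>. Values off the closure of \<open>D1 \<union> D2\<close> are irrelevant.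
\<close>

definition K_diag :: "(real^3) set \<Rightarrow> (real^3) set \<Rightarrow> field \<Rightarrow> field" where
  "K_diag D1 D2 u x =
     (if x \<in> closure D1 then newton D1 u x
      else if x \<in> closure D2 then newton D2 u x else 0)"

definition K_off :: "(real^3) set \<Rightarrow> (real^3) set \<Rightarrow> field \<Rightarrow> field" where
  "K_off D1 D2 u x =
     (if x \<in> closure D1 then newton D2 u x
      else if x \<in> closure D2 then newton D1 u x else 0)"

definition spectral_gap :: "(real^3) set \<Rightarrow> (real^3) set \<Rightarrow> complex \<Rightarrow> real" where
  "spectral_gap D1 D2 \<rho> = infdist \<rho> (l2_spectrum (D1 \<union> D2) (K_diag D1 D2) - {\<rho>})"

definition eps2 :: "(real^3) set \<Rightarrow> (real^3) set \<Rightarrow> real" where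
  "eps2 D1 D2 = opnorm_l2_l2 (D1 \<union> D2) (K_off D1 D2)"

definition eps_inf :: "(real^3) set \<Rightarrow> (real^3) set \<Rightarrow> real" where
  "eps_inf D1 D2 = opnorm_l2_C0 (D1 \<union> D2) (K_off D1 D2)"

definition C0_diag :: "(real^3) set \<Rightarrow> (real^3) set \<Rightarrow> real" where
  "C0_diag D1 D2 = opnorm_l2_C0 (D1 \<union> D2) (K_diag D1 D2)"

text \<open>
  The projection \<open>Q = I - P\<close>, where \<open>P\<close> is the orthogonal projection onto the span of a
  normalized \<open>\<Phi>\<close>, and the reduced resolvent \<open>Q (T - \<rho> I)\<^sup>-\<^sup>1 Q\<close>. The inverse is that of
  \<open>T - \<rho> I\<close> restricted to the range of \<open>Q\<close>; it is determined up to \<open>l2_eq\<close>.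
\<close>

definition proj_compl :: "(real^3) set \<Rightarrow> field \<Rightarrow> field \<Rightarrow> field" where
  "proj_compl D \<Phi> u = (\<lambda>x. u x - l2_inner D u \<Phi> * \<Phi> x)"

definition reduced_resolvent ::
    "(real^3) set \<Rightarrow> (field \<Rightarrow> field) \<Rightarrow> complex \<Rightarrow> field \<Rightarrow> field \<Rightarrow> field" where
  "reduced_resolvent D T \<rho> \<Phi> f =
     proj_compl D \<Phi> (SOME v. v \<in> l2_space D \<and> l2_inner D v \<Phi> = 0 \<and>
                          l2_eq D (\<lambda>x. T v x - \<rho> * v x) (proj_compl D \<Phi> f))"

definition coupled_eigenpair ::
    "(real^3) set \<Rightarrow> (real^3) set \<Rightarrow> complex \<Rightarrow> field \<Rightarrow> real \<Rightarrow> complex \<Rightarrow> field \<Rightarrow> bool" where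
  "coupled_eigenpair D1 D2 \<rho> \<Phi> C1 \<rho>\<kappa> \<Phi>\<kappa> \<longleftrightarrow>
     (let D = D1 \<union> D2; d = spectral_gap D1 D2 \<rho>; \<epsilon>2 = eps2 D1 D2;
          \<delta>\<phi> = (\<lambda>x. \<Phi>\<kappa> x - \<Phi> x); \<delta>\<rho> = \<rho>\<kappa> - \<rho>;
          S = reduced_resolvent D (K_diag D1 D2) \<rho> \<Phi>
      in eigenfunction D (K_full D1 D2) \<rho>\<kappa> \<Phi>\<kappa> \<and>
         l2_norm D \<Phi>\<kappa> = 1 \<and>
         l2_inner D \<Phi>\<kappa> \<Phi> \<in> \<real> \<and> 0 < Re (l2_inner D \<Phi>\<kappa> \<Phi>) \<and>
         l2_norm D \<delta>\<phi> \<le> C1 * (\<epsilon>2 / d) \<and>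
         l2_norm D (\<lambda>x. \<delta>\<phi> x + S (K_off D1 D2 \<Phi>) x) \<le> C1 * (\<epsilon>2\<^sup>2 / d\<^sup>2) \<and>
         norm (\<delta>\<rho> - l2_inner D (K_off D1 D2 \<Phi>) \<Phi>) \<le> C1 * (\<epsilon>2\<^sup>2 / d))"

end

theory Submission
  imports Defs
begin

text \<open>
  Evaluating the coupled eigenvalue equation pointwise and subtracting the uncoupled one gives, with
  \<open>\<delta>\<phi> = \<Phi>\<kappa> - \<Phi>\<close> and \<open>\<delta>\<rho> = \<rho>\<kappa> - \<rho>\<close>,
  \<open>\<rho>\<kappa> \<delta>\<phi> = K_diag \<delta>\<phi> + K_off \<Phi> + K_off \<delta>\<phi> - \<delta>\<rho> \<Phi>\<close>.
  Since the operators map \<open>L\<^sup>2\<close> to bounded functions, the first three terms are bounded uniformly by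
  \<open>C0 \<parallel>\<delta>\<phi>\<parallel>\<close>, \<open>\<epsilon>\<^sub>\<infinity>\<close> and \<open>\<epsilon>\<^sub>\<infinity> \<parallel>\<delta>\<phi>\<parallel>\<close>, with \<open>L\<^sup>2\<close> norms on the right. The last one is bounded through
  \<open>\<bar>\<Phi>\<bar> = \<bar>K_diag \<Phi>\<bar> / \<bar>\<rho>\<bar> \<le> C0 / \<bar>\<rho>\<bar>\<close>. Inserting the bounds for \<open>\<parallel>\<delta>\<phi>\<parallel>\<close> and \<open>\<bar>\<delta>\<rho>\<bar>\<close> and dividing by
  \<open>\<bar>\<rho>\<kappa>\<bar> \<ge> \<bar>\<rho>\<bar> / 2\<close> gives the four terms of the estimate.

  The analytic content is the boundedness of the operators into the bounded functions, without
  which the suprema that define \<open>C0\<close> and \<open>\<epsilon>\<^sub>\<infinity>\<close> would not control anything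
  (\<open>norm_le_opnorm_l2_C0\<close>). It comes down to a bound on \<open>\<integral> 1 / \<bar>x - y\<bar>\<^sup>2\<close> over \<open>y\<close> in a ball, uniform in the
  centre \<open>x\<close> (\<open>inverse_dist_square_ball\<close>).

  The eigenvalue equations hold only almost everywhere, and so does the estimate at first. As \<open>\<delta>\<phi>\<close>
  is continuous on the closure of an open set, it extends to every point there
  (\<open>AE_norm_le_imp_closure\<close>).
\<close>

section \<open>The square of the Newtonian kernel is locally integrable\<close>

text \<open>
  The ball is cut into the dyadic shells \<open>R / 2 ^ (k + 1) \<le> \<bar>x - y\<bar> < R / 2 ^ k\<close>. On each of them the
  function is at most \<open>4 ^ (k + 1) / R\<^sup>2\<close>, while the volume decays like \<open>8 ^ -k\<close>.
\<close>

lemma inverse_dist_square_le_shells: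
  fixes x y :: "real^3"
  assumes "dist x y < R"
  shows "ennreal (1 / (dist x y)\<^sup>2)
           \<le> (\<Sum>k. ennreal (4 ^ (k + 1) / R\<^sup>2) * indicator (ball x (R / 2 ^ k)) y)"
proof (cases "x = y")
  case False
  define z where "z = dist x y"
  have z: "0 < z" "z < R" using False assms by (auto simp: z_def)
  obtain n where n: "(1 / 2) ^ n < z / R"
    using real_arch_pow_inv[of "z / R" "1 / 2"] z by auto
  \<comment> \<open>Since \<open>z < R\<close>, the least such index is positive, and the shell of \<open>y\<close> has the preceding one.\<close>
  define m where "m = (LEAST n. R / 2 ^ n \<le> z)"
  have "R / 2 ^ n \<le> z"
    using n z by (simp add: field_simps)
  then have m: "R / 2 ^ m \<le> z" unfolding m_def by (rule LeastI)
  have "m \<noteq> 0" using m z by (intro notI) simp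
  then obtain k where k: "m = Suc k" by (cases m) auto
  have "\<not> R / 2 ^ k \<le> z" using not_less_Least[of k "\<lambda>n. R / 2 ^ n \<le> z"] k m_def by simp
  then have zk: "y \<in> ball x (R / 2 ^ k)" by (simp add: z_def)
  have "(R / 2 ^ (k + 1))\<^sup>2 \<le> z\<^sup>2" using m k z by (intro power_mono) auto
  then have "1 / z\<^sup>2 \<le> 1 / (R / 2 ^ (k + 1))\<^sup>2"
    using z by (intro divide_left_mono) auto
  also have "\<dots> = 4 ^ (k + 1) / R\<^sup>2"
  proof -
    have "(2 ^ (k + 1))\<^sup>2 = (2 * 2 :: real) ^ (k + 1)"
      by (simp only: power_mult_distrib power2_eq_square)
    then show ?thesis by (simp add: power_divide del: power_Suc)
  qed
  finally have "ennreal (1 / z\<^sup>2)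
      \<le> (\<Sum>j\<in>{k}. ennreal (4 ^ (j + 1) / R\<^sup>2) * indicator (ball x (R / 2 ^ j)) y)"
    using zk by (auto intro: ennreal_leI)
  also have "\<dots> \<le> (\<Sum>j. ennreal (4 ^ (j + 1) / R\<^sup>2) * indicator (ball x (R / 2 ^ j)) y)"
    by (intro sum_le_suminf) auto
  finally show ?thesis by (simp add: z_def)
qed simp

lemma nn_integral_inverse_dist_square_ball:
  fixes x :: "real^3"
  assumes "0 < R"
  shows "(\<integral>\<^sup>+y. ennreal (1 / (dist x y)\<^sup>2) * indicator (ball x R) y \<partial>lborel)
           \<le> ennreal (8 * unit_ball_vol 3 * R)"
proof -
  let ?c = "\<lambda>k::nat. 4 ^ (k + 1) / R\<^sup>2"
  have "(\<integral>\<^sup>+y. ennreal (1 / (dist x y)\<^sup>2) * indicator (ball x R) y \<partial>lborel)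
      \<le> (\<integral>\<^sup>+y. (\<Sum>k. ennreal (?c k) * indicator (ball x (R / 2 ^ k)) y) \<partial>lborel)"
    by (intro nn_integral_mono)
      (use inverse_dist_square_le_shells[of x _ R] in \<open>auto simp: indicator_def\<close>)
  also have "\<dots> = (\<Sum>k. \<integral>\<^sup>+y. ennreal (?c k) * indicator (ball x (R / 2 ^ k)) y \<partial>lborel)"
    by (intro nn_integral_suminf borel_measurable_times_ennreal borel_measurable_const
        borel_measurable_indicator) simp
  also have "\<dots> = (\<Sum>k. ennreal (4 * unit_ball_vol 3 * R * (1 / 2) ^ k))"
  proof (intro suminf_cong)
    fix k
    have "(\<integral>\<^sup>+y. ennreal (?c k) * indicator (ball x (R / 2 ^ k)) y \<partial>lborel)
        = ennreal (?c k) * emeasure lborel (ball x (R / 2 ^ k))"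
      by (rule nn_integral_cmult_indicator) auto
    also have "\<dots> = ennreal (?c k * (unit_ball_vol 3 * (R / 2 ^ k) ^ 3))"
      using assms by (simp add: emeasure_ball del: power_Suc flip: ennreal_mult)
    also have "?c k * (unit_ball_vol 3 * (R / 2 ^ k) ^ 3) = 4 * unit_ball_vol 3 * R * (1 / 2) ^ k"
    proof -
      have "(2 * 2 :: real) ^ k = 2 ^ k * 2 ^ k" by (simp only: power_mult_distrib)
      then show ?thesis using assms
        by (simp add: field_simps power2_eq_square power3_eq_cube)
    qed
    finally show "(\<integral>\<^sup>+y. ennreal (?c k) * indicator (ball x (R / 2 ^ k)) y \<partial>lborel)
        = ennreal (4 * unit_ball_vol 3 * R * (1 / 2) ^ k)" .
  qed
  also have "\<dots> = ennreal (4 * unit_ball_vol 3 * R * 2)"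
  proof (rule suminf_ennreal_eq)
    show "(\<lambda>k. 4 * unit_ball_vol 3 * R * (1 / 2) ^ k) sums (4 * unit_ball_vol 3 * R * 2)"
      using geometric_sums[of "1 / 2 :: real"] by (intro sums_mult) auto
  qed (use assms in auto)
  finally show ?thesis by (simp add: mult_ac)
qed

lemma inverse_dist_square_ball:
  fixes x :: "real^3"
  assumes E: "E \<in> sets lebesgue" "E \<subseteq> ball x R" and R: "0 < R"
  shows "integrable (lebesgue_on E) (\<lambda>y. 1 / (dist x y)\<^sup>2)"
    and "(LINT y|lebesgue_on E. 1 / (dist x y)\<^sup>2) \<le> 8 * unit_ball_vol 3 * R"
proof -
  have meas: "(\<lambda>y. 1 / (dist x y)\<^sup>2) \<in> borel_measurable lebesgue"
    by (intro measurable_completion) (simp, measurable)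
  then have measE: "(\<lambda>y. 1 / (dist x y)\<^sup>2) \<in> borel_measurable (lebesgue_on E)"
    by (rule measurable_restrict_space1)
  have "(\<integral>\<^sup>+y. ennreal (1 / (dist x y)\<^sup>2) \<partial>lebesgue_on E)
      = (\<integral>\<^sup>+y. ennreal (1 / (dist x y)\<^sup>2) * indicator E y \<partial>lebesgue)"
    using E by (intro nn_integral_restrict_space) simp
  also have "\<dots> \<le> (\<integral>\<^sup>+y. ennreal (1 / (dist x y)\<^sup>2) * indicator (ball x R) y \<partial>lebesgue)"
    using E by (intro nn_integral_mono) (auto simp: indicator_def)
  also have "\<dots> \<le> ennreal (8 * unit_ball_vol 3 * R)"
    using nn_integral_inverse_dist_square_ball[OF R] by (simp add: nn_integral_completion)
  finally have le: "(\<integral>\<^sup>+y. ennreal (1 / (dist x y)\<^sup>2) \<partial>lebesgue_on E) \<le> ennreal (8 * unit_ball_vol 3 * R)" .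
  have "(\<integral>\<^sup>+y. ennreal (norm (1 / (dist x y)\<^sup>2)) \<partial>lebesgue_on E) < \<infinity>"
    using le by (simp add: le_less_trans[OF _ ennreal_less_top])
  then show int: "integrable (lebesgue_on E) (\<lambda>y. 1 / (dist x y)\<^sup>2)"
    using measE by (intro integrableI_bounded)
  show "(LINT y|lebesgue_on E. 1 / (dist x y)\<^sup>2) \<le> 8 * unit_ball_vol 3 * R"
    using le R by (subst (asm) nn_integral_eq_integral[OF int]) auto
qed

section \<open>The Newtonian potential of a square integrable density\<close>

lemma l2_space_subset:
  assumes "u \<in> l2_space D" "E \<subseteq> D" "E \<in> sets lebesgue" "D \<in> sets lebesgue"
  shows "u \<in> l2_space E" "l2_norm E u \<le> l2_norm D u"
proof -
  have int_iff: "integrable (lebesgue_on F) f \<longleftrightarrow> set_integrable lebesgue F f"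
    and int_eq: "integral\<^sup>L (lebesgue_on F) f = (LINT x:F|lebesgue. f x)"
    if "F \<in> sets lebesgue" for F and f :: "real^3 \<Rightarrow> real"
  proof -
    have "F \<inter> space lebesgue \<in> sets lebesgue" using that by simp
    from integrable_restrict_space[OF this] integral_restrict_space[OF this]
    show "integrable (lebesgue_on F) f \<longleftrightarrow> set_integrable lebesgue F f"
      and "integral\<^sup>L (lebesgue_on F) f = (LINT x:F|lebesgue. f x)"
      unfolding set_integrable_def set_lebesgue_integral_def by blast+
  qed
  have D: "set_integrable lebesgue D (\<lambda>x. (norm (u x))\<^sup>2)"
    using assms(1) unfolding l2_space_def int_iff[OF assms(4)] by blast
  then have E: "set_integrable lebesgue E (\<lambda>x. (norm (u x))\<^sup>2)"
    by (rule set_integrable_subset[OF _ assms(3,2)])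
  have "u \<in> borel_measurable (lebesgue_on E)"
    using measurable_restrict_mono[OF _ assms(2)] assms(1) unfolding l2_space_def by blast
  with E show "u \<in> l2_space E"
    unfolding l2_space_def int_iff[OF assms(3)] by blast
  have "(LINT x:E|lebesgue. (norm (u x))\<^sup>2) \<le> (LINT x:D|lebesgue. (norm (u x))\<^sup>2)"
    unfolding set_lebesgue_integral_def
  proof (rule integral_mono[OF E[unfolded set_integrable_def] D[unfolded set_integrable_def]])
    show "indicat_real E x *\<^sub>R (norm (u x))\<^sup>2 \<le> indicat_real D x *\<^sub>R (norm (u x))\<^sup>2" for x
      using assms(2) by (auto simp: indicator_def)
  qed
  then show "l2_norm E u \<le> l2_norm D u"
    unfolding l2_norm_def int_eq[OF assms(3)] int_eq[OF assms(4)] by simp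
qed

lemma l2_norm_cmult: "l2_norm D (\<lambda>x. a * u x) = norm a * l2_norm D u"
  by (simp add: l2_norm_def norm_mult power_mult_distrib real_sqrt_mult)

lemma l2_space_cmult: "u \<in> l2_space D \<Longrightarrow> (\<lambda>x. a * u x) \<in> l2_space D"
  by (auto simp: l2_space_def norm_mult power_mult_distrib)

lemma l2_norm_nonneg: "0 \<le> l2_norm D u"
  by (simp add: l2_norm_def)

lemma l2_space_diff:
  assumes u: "u \<in> l2_space D" and v: "v \<in> l2_space D"
  shows "(\<lambda>x. u x - v x) \<in> l2_space D"
proof -
  have meas: "(\<lambda>x. u x - v x) \<in> borel_measurable (lebesgue_on D)"
    using u v by (auto simp: l2_space_def)
  have "integrable (lebesgue_on D) (\<lambda>x. 2 * (norm (u x))\<^sup>2 + 2 * (norm (v x))\<^sup>2)"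
    using u v by (auto simp: l2_space_def)
  then have "integrable (lebesgue_on D) (\<lambda>x. (norm (u x - v x))\<^sup>2)"
  proof (rule Bochner_Integration.integrable_bound)
    show "(\<lambda>x. (norm (u x - v x))\<^sup>2) \<in> borel_measurable (lebesgue_on D)"
      using meas by measurable
    show "AE x in lebesgue_on D. norm ((norm (u x - v x))\<^sup>2)
            \<le> norm (2 * (norm (u x))\<^sup>2 + 2 * (norm (v x))\<^sup>2)"
    proof (rule AE_I2)
      fix x
      have "(norm (u x - v x))\<^sup>2 \<le> (norm (u x) + norm (v x))\<^sup>2"
        by (intro power_mono norm_triangle_ineq4) simp
      also have "\<dots> \<le> 2 * (norm (u x))\<^sup>2 + 2 * (norm (v x))\<^sup>2"
        using zero_le_power2[of "norm (u x) - norm (v x)"]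
        by (simp add: power2_sum power2_diff)
      finally show "norm ((norm (u x - v x))\<^sup>2) \<le> norm (2 * (norm (u x))\<^sup>2 + 2 * (norm (v x))\<^sup>2)"
        by simp
    qed
  qed
  with meas show ?thesis by (simp add: l2_space_def)
qed

text \<open>
  By the inequality of arithmetic and geometric means, \<open>\<bar>u\<bar> / r \<le> (\<bar>u\<bar>\<^sup>2 + 1 / r\<^sup>2) / 2\<close>. The resulting
  bound is not homogeneous in \<open>u\<close>, but the passage to operator norms below only asks for
  boundedness on the unit ball.
\<close>

lemma newton_integral:
  assumes u: "u \<in> l2_space E" and E: "E \<in> sets lebesgue" "E \<subseteq> ball x R" and R: "0 < R"
  shows integrable_newton: "integrable (lebesgue_on E) (\<lambda>y. u y / of_real (dist x y))"
    and norm_newton_le: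
      "norm (newton E u x) \<le> ((l2_norm E u)\<^sup>2 + 8 * unit_ball_vol 3 * R) / (8 * pi)"
proof -
  note k = inverse_dist_square_ball[OF E R]
  let ?g = "\<lambda>y. ((norm (u y))\<^sup>2 + 1 / (dist x y)\<^sup>2) / 2"
  have g: "integrable (lebesgue_on E) ?g"
    using u k(1) by (auto simp: l2_space_def)
  have le: "norm (u y / of_real (dist x y)) \<le> ?g y" for y
    using zero_le_power2[of "norm (u y) - 1 / dist x y"]
    by (simp add: power2_diff norm_divide power_divide mult.commute)
  have "(\<lambda>y. complex_of_real (dist x y)) \<in> borel_measurable (lebesgue_on E)"
    by (intro measurable_restrict_space1 measurable_completion) (simp, measurable)
  moreover have "u \<in> borel_measurable (lebesgue_on E)" using u by (simp add: l2_space_def)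
  ultimately have meas: "(\<lambda>y. u y / of_real (dist x y)) \<in> borel_measurable (lebesgue_on E)"
    by measurable
  show int: "integrable (lebesgue_on E) (\<lambda>y. u y / of_real (dist x y))"
    using g meas
  proof (rule Bochner_Integration.integrable_bound)
    show "AE y in lebesgue_on E. norm (u y / of_real (dist x y)) \<le> norm (?g y)"
      using order_trans[OF le abs_ge_self] by (intro AE_I2) (simp only: real_norm_def)
  qed
  have "norm (LINT y|lebesgue_on E. u y / of_real (dist x y)) \<le> (LINT y|lebesgue_on E. ?g y)"
    by (rule Bochner_Integration.integral_norm_bound_integral[OF int g le])
  also have "\<dots> = ((l2_norm E u)\<^sup>2 + (LINT y|lebesgue_on E. 1 / (dist x y)\<^sup>2)) / 2"
    using u k(1) by (simp add: l2_space_def l2_norm_def)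
  also have "\<dots> \<le> ((l2_norm E u)\<^sup>2 + 8 * unit_ball_vol 3 * R) / 2"
    using k(2) by (intro divide_right_mono add_left_mono) auto
  finally have "norm (newton E u x) \<le> 1 / (4 * pi) * (((l2_norm E u)\<^sup>2 + 8 * unit_ball_vol 3 * R) / 2)"
    by (simp add: newton_def field_simps)
  then show "norm (newton E u x) \<le> ((l2_norm E u)\<^sup>2 + 8 * unit_ball_vol 3 * R) / (8 * pi)"
    by simp
qed

lemma ex_ball_around_closure:
  fixes D :: "(real^3) set"
  assumes "bounded D"
  obtains R where "0 < R" "\<And>x. x \<in> closure D \<Longrightarrow> D \<subseteq> ball x R"
proof -
  have "bounded (closure D)" using assms by (rule bounded_closure)
  then obtain r where r: "0 < r" "\<And>x. x \<in> closure D \<Longrightarrow> norm x < r"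
    using bounded_pos_less[of "closure D"] by auto
  show ?thesis
  proof (rule that[of "2 * r"])
    fix x assume x: "x \<in> closure D"
    show "D \<subseteq> ball x (2 * r)"
    proof
      fix y assume "y \<in> D"
      then have "norm y < r" using r(2) closure_subset by blast
      then show "y \<in> ball x (2 * r)"
        using r(2)[OF x] norm_triangle_ineq4[of x y] by (simp add: dist_norm)
    qed
  qed (use r in simp)
qed

lemma newton_cmult: "newton E (\<lambda>y. a * u y) x = a * newton E u x"
  unfolding newton_def times_divide_eq_right[symmetric] integral_mult_right_zero mult_scaleR_right ..

lemma newton_eq_set_integral:
  assumes "E \<in> sets lebesgue"
  shows "newton E u x = - (1 / (4 * pi)) *\<^sub>R (LINT y:E|lebesgue. u y / of_real (dist x y))"
proof -
  have "integral\<^sup>L (lebesgue_on E) f = (LINT y:E|lebesgue. f y)" for f :: field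
    unfolding set_lebesgue_integral_def
    by (rule integral_restrict_space) (use assms in simp)
  then show ?thesis unfolding newton_def by (rule arg_cong)
qed

lemma newton_diff:
  assumes "u \<in> l2_space E" "v \<in> l2_space E" "E \<in> sets lebesgue" "bounded E"
  shows "newton E (\<lambda>y. u y - v y) x = newton E u x - newton E v x"
proof -
  obtain R where "0 < R" "E \<subseteq> ball x R"
    using bounded_subset_ballD[OF assms(4)] by blast
  then show ?thesis
    using integrable_newton[OF assms(1,3), of x R] integrable_newton[OF assms(2,3), of x R]
    by (simp only: newton_def diff_divide_distrib Bochner_Integration.integral_diff
        scaleR_diff_right)
qed

lemma newton_Un:
  assumes u: "u \<in> l2_space (E \<union> F)" and "E \<inter> F = {}"
    and sets: "E \<in> sets lebesgue" "F \<in> sets lebesgue" and "bounded (E \<union> F)"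
  shows "newton (E \<union> F) u x = newton E u x + newton F u x"
proof -
  obtain R where R: "0 < R" "E \<union> F \<subseteq> ball x R"
    using bounded_subset_ballD[OF assms(5)] by blast
  let ?f = "\<lambda>y. u y / complex_of_real (dist x y)"
  have "u \<in> l2_space E" "u \<in> l2_space F"
    using l2_space_subset(1)[OF u] sets by auto
  then have "integrable (lebesgue_on E) ?f" "integrable (lebesgue_on F) ?f"
    using R sets by (blast intro: integrable_newton)+
  then have int: "set_integrable lebesgue E ?f" "set_integrable lebesgue F ?f"
    using sets by (simp_all add: set_integrable_def integrable_restrict_space)
  have "(LINT y:E \<union> F|lebesgue. ?f y) = (LINT y:E|lebesgue. ?f y) + (LINT y:F|lebesgue. ?f y)"
    by (rule set_integral_Un[OF assms(2) int])
  then show ?thesis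
    unfolding newton_eq_set_integral[OF sets(1)] newton_eq_set_integral[OF sets(2)]
      newton_eq_set_integral[OF sets.Un[OF sets]] scaleR_add_right[symmetric]
    by (rule arg_cong)
qed

section \<open>Operator norms into the bounded functions\<close>

text \<open>
  Boundedness on the unit ball makes both suprema in \<open>opnorm_l2_C0\<close> genuine, and homogeneity
  removes the normalization. A function of norm zero cannot be normalized; but all its multiples
  lie in the unit ball, so its image is bounded by \<open>M / n\<close> for every \<open>n > 0\<close> and hence vanishes.
\<close>

lemma norm_le_opnorm_l2_C0:
  assumes hom: "\<And>a u x. T (\<lambda>y. a * u y) x = a * T u x"
    and bd: "\<And>u x. u \<in> l2_space D \<Longrightarrow> l2_norm D u \<le> 1 \<Longrightarrow> x \<in> closure D \<Longrightarrow> norm (T u x) \<le> M"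
    and u: "u \<in> l2_space D" and x: "x \<in> D"
  shows "norm (T u x) \<le> opnorm_l2_C0 D T * l2_norm D u"
proof -
  have xc: "x \<in> closure D" using x closure_subset by blast
  have unit: "norm (T v x) \<le> opnorm_l2_C0 D T" if v: "v \<in> l2_space D" "l2_norm D v \<le> 1" for v
  proof -
    have "norm (T v x) \<le> sup_norm (closure D) (T v)"
      unfolding sup_norm_def using bd v xc
      by (intro cSUP_upper) (auto intro!: bdd_aboveI[where M = M])
    also have "\<dots> \<le> opnorm_l2_C0 D T"
      unfolding opnorm_l2_C0_def
    proof (rule cSUP_upper)
      show "bdd_above ((\<lambda>u. sup_norm (closure D) (T u)) ` {u \<in> l2_space D. l2_norm D u \<le> 1})"
        unfolding sup_norm_def
        using bd xc by (intro bdd_aboveI[where M = M]) (auto intro!: cSUP_least)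
    qed (use v in simp)
    finally show ?thesis .
  qed
  show ?thesis
  proof (cases "l2_norm D u = 0")
    case True
    have "T u x = 0"
    proof (rule ccontr)
      assume "T u x \<noteq> 0"
      then obtain n :: nat where "M < real n * norm (T u x)"
        using reals_Archimedean3[of "norm (T u x)"] by auto
      moreover have "norm (T (\<lambda>y. of_nat n * u y) x) \<le> M"
        using bd[OF l2_space_cmult[OF u] _ xc] True by (simp add: l2_norm_cmult)
      ultimately show False by (simp add: hom norm_mult)
    qed
    with True show ?thesis by simp
  next
    case False
    then have pos: "0 < l2_norm D u" using l2_norm_nonneg[of D u] by simp
    let ?a = "complex_of_real (1 / l2_norm D u)"
    have "norm (T (\<lambda>y. ?a * u y) x) \<le> opnorm_l2_C0 D T"
    proof (intro unit l2_space_cmult[OF u])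
      show "l2_norm D (\<lambda>y. ?a * u y) \<le> 1"
        using pos unfolding l2_norm_cmult by (simp add: norm_divide)
    qed
    then have "1 / l2_norm D u * norm (T u x) \<le> opnorm_l2_C0 D T"
      using pos unfolding hom by (simp add: norm_mult norm_divide)
    with pos show ?thesis by (simp add: field_simps)
  qed
qed

lemma newton_bounded_on_unit_ball:
  assumes "bounded D" "D \<in> sets lebesgue"
  obtains M where "0 \<le> M"
    "\<And>E u x. E \<in> sets lebesgue \<Longrightarrow> E \<subseteq> D \<Longrightarrow> u \<in> l2_space D \<Longrightarrow> l2_norm D u \<le> 1 \<Longrightarrow>
       x \<in> closure D \<Longrightarrow> norm (newton E u x) \<le> M"
proof -
  obtain R where R: "0 < R" "\<And>x. x \<in> closure D \<Longrightarrow> D \<subseteq> ball x R"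
    using ex_ball_around_closure[OF assms(1)] by blast
  show ?thesis
  proof (rule that[of "(1 + 8 * unit_ball_vol 3 * R) / (8 * pi)"])
    fix E u x
    assume E: "E \<in> sets lebesgue" "E \<subseteq> D" and u: "u \<in> l2_space D" "l2_norm D u \<le> 1"
      and x: "x \<in> closure D"
    note uE = l2_space_subset[OF u(1) E(2,1) assms(2)]
    have "(l2_norm E u)\<^sup>2 \<le> 1"
      using uE(2) u(2) l2_norm_nonneg[of E u] by (intro power_le_one) auto
    then have "((l2_norm E u)\<^sup>2 + 8 * unit_ball_vol 3 * R) / (8 * pi)
        \<le> (1 + 8 * unit_ball_vol 3 * R) / (8 * pi)"
      by (intro divide_right_mono add_right_mono) auto
    moreover have "norm (newton E u x) \<le> ((l2_norm E u)\<^sup>2 + 8 * unit_ball_vol 3 * R) / (8 * pi)"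
      using norm_newton_le[OF uE(1) E(1) _ R(1)] E(2) R(2)[OF x] by blast
    ultimately show "norm (newton E u x) \<le> (1 + 8 * unit_ball_vol 3 * R) / (8 * pi)"
      by (rule order_trans[rotated])
  qed (use R in simp)
qed

lemma K_bounds:
  fixes D1 D2 :: "(real^3) set"
  assumes "bounded D1" "bounded D2" "D1 \<in> sets lebesgue" "D2 \<in> sets lebesgue"
    and u: "u \<in> l2_space (D1 \<union> D2)" and x: "x \<in> D1 \<union> D2"
  shows norm_K_diag_le: "norm (K_diag D1 D2 u x) \<le> C0_diag D1 D2 * l2_norm (D1 \<union> D2) u"
    and norm_K_off_le: "norm (K_off D1 D2 u x) \<le> eps_inf D1 D2 * l2_norm (D1 \<union> D2) u"
proof -
  have D: "bounded (D1 \<union> D2)" "D1 \<union> D2 \<in> sets lebesgue" using assms(1-4) by auto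
  obtain M where M: "0 \<le> M" "\<And>E u x. E \<in> sets lebesgue \<Longrightarrow> E \<subseteq> D1 \<union> D2 \<Longrightarrow> u \<in> l2_space (D1 \<union> D2)
       \<Longrightarrow> l2_norm (D1 \<union> D2) u \<le> 1 \<Longrightarrow> x \<in> closure (D1 \<union> D2) \<Longrightarrow> norm (newton E u x) \<le> M"
    using newton_bounded_on_unit_ball[OF D] by blast
  have N: "norm (newton D1 v y) \<le> M" "norm (newton D2 v y) \<le> M"
    if "v \<in> l2_space (D1 \<union> D2)" "l2_norm (D1 \<union> D2) v \<le> 1" "y \<in> closure (D1 \<union> D2)" for v y
    using M(2)[OF assms(3) _ that] M(2)[OF assms(4) _ that] by simp_all
  show "norm (K_diag D1 D2 u x) \<le> C0_diag D1 D2 * l2_norm (D1 \<union> D2) u"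
    unfolding C0_diag_def
  proof (rule norm_le_opnorm_l2_C0[where M = M, OF _ _ u x])
    show "norm (K_diag D1 D2 v y) \<le> M"
      if "v \<in> l2_space (D1 \<union> D2)" "l2_norm (D1 \<union> D2) v \<le> 1" "y \<in> closure (D1 \<union> D2)" for v y
      using N[OF that] M(1) unfolding K_diag_def by (simp split: if_split)
  qed (simp add: K_diag_def newton_cmult)
  show "norm (K_off D1 D2 u x) \<le> eps_inf D1 D2 * l2_norm (D1 \<union> D2) u"
    unfolding eps_inf_def
  proof (rule norm_le_opnorm_l2_C0[where M = M, OF _ _ u x])
    show "norm (K_off D1 D2 v y) \<le> M"
      if "v \<in> l2_space (D1 \<union> D2)" "l2_norm (D1 \<union> D2) v \<le> 1" "y \<in> closure (D1 \<union> D2)" for v y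
      using N[OF that] M(1) unfolding K_off_def by (simp split: if_split)
  qed (simp add: K_off_def newton_cmult)
qed

section \<open>Algebra of the block operators\<close>

lemma K_full_eq:
  fixes D1 D2 :: "(real^3) set"
  assumes "bounded D1" "bounded D2" "D1 \<in> sets lebesgue" "D2 \<in> sets lebesgue"
    and dist: "0 < setdist D1 D2"
    and u: "u \<in> l2_space (D1 \<union> D2)" and x: "x \<in> D1 \<union> D2"
  shows "K_full D1 D2 u x = K_diag D1 D2 u x + K_off D1 D2 u x"
proof -
  have disj: "D1 \<inter> D2 = {}" using dist setdist_eq_0I[of _ D1 D2] by fastforce
  \<comment> \<open>The block operators test the closure of \<open>D1\<close> first, so a point of \<open>D2\<close> must not lie in it.\<close>
  have "closure D1 \<inter> D2 = {}"
    using dist setdist_eq_0I[of _ "closure D1" D2] by fastforce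
  then have "x \<in> closure D1 \<or> x \<notin> closure D1 \<and> x \<in> closure D2"
    using x closure_subset by blast
  moreover have "newton (D1 \<union> D2) u x = newton D1 u x + newton D2 u x"
    using assms disj by (intro newton_Un) auto
  ultimately show ?thesis by (auto simp: K_full_def K_diag_def K_off_def)
qed

lemma K_diff:
  fixes D1 D2 :: "(real^3) set"
  assumes "bounded D1" "bounded D2" "D1 \<in> sets lebesgue" "D2 \<in> sets lebesgue"
    and u: "u \<in> l2_space (D1 \<union> D2)" and v: "v \<in> l2_space (D1 \<union> D2)"
  shows K_diag_diff:
      "K_diag D1 D2 (\<lambda>y. u y - v y) x = K_diag D1 D2 u x - K_diag D1 D2 v x"
    and K_off_diff:
      "K_off D1 D2 (\<lambda>y. u y - v y) x = K_off D1 D2 u x - K_off D1 D2 v x"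
proof -
  have "u \<in> l2_space D1" "u \<in> l2_space D2" "v \<in> l2_space D1" "v \<in> l2_space D2"
    using l2_space_subset(1)[OF u] l2_space_subset(1)[OF v] assms by auto
  then have "newton D1 (\<lambda>y. u y - v y) x = newton D1 u x - newton D1 v x"
    "newton D2 (\<lambda>y. u y - v y) x = newton D2 u x - newton D2 v x"
    using assms by (auto intro: newton_diff)
  then show "K_diag D1 D2 (\<lambda>y. u y - v y) x = K_diag D1 D2 u x - K_diag D1 D2 v x"
    "K_off D1 D2 (\<lambda>y. u y - v y) x = K_off D1 D2 u x - K_off D1 D2 v x"
    by (auto simp: K_diag_def K_off_def)
qed

text \<open>
  The set of points of \<open>D\<close> where the bound fails is relatively open, hence open, and a nonempty open
  set is not negligible.
\<close>

lemma AE_norm_le_imp_closure: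
  fixes f :: field
  assumes "open D" and cont: "continuous_on (closure D) f"
    and ae: "AE x in lebesgue_on D. norm (f x) \<le> B" and x: "x \<in> closure D"
  shows "norm (f x) \<le> B"
proof -
  let ?S = "{x \<in> D. B < norm (f x)}"
  have contD: "continuous_on D f" by (rule continuous_on_subset[OF cont closure_subset])
  have "open (D \<inter> (\<lambda>x. norm (f x)) -` {B<..})"
    by (rule continuous_open_preimage) (use assms(1) contD in \<open>auto intro: continuous_intros\<close>)
  moreover have "D \<inter> (\<lambda>x. norm (f x)) -` {B<..} = ?S" by auto
  ultimately have "open ?S" by simp
  have "AE x in lebesgue. x \<in> D \<longrightarrow> norm (f x) \<le> B"
    using ae assms(1) by (subst (asm) AE_restrict_space_iff) auto
  then have "AE x in lebesgue. x \<notin> ?S" by eventually_elim auto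
  then have "negligible ?S"
    using \<open>open ?S\<close> by (simp add: negligible_iff_null_sets AE_iff_null_sets)
  then have "?S = {}" using \<open>open ?S\<close> open_not_negligible by blast
  then have "\<forall>y\<in>D. norm (f y) \<le> B" by force
  with cont x show ?thesis by (intro continuous_on_closure_norm_le) auto
qed

section \<open>The estimate for the perturbed eigenfunction\<close>

text \<open>
  The sup norm of the perturbation is controlled by its own \<open>L\<^sup>2\<close> norm, because the right-hand side of
  the equation for \<open>\<rho>\<kappa> \<delta>\<phi>\<close> contains \<open>\<delta>\<phi>\<close> only under the smoothing integral operators.
\<close>

lemma eigenfunction_perturbation_sup_norm:
  fixes D1 D2 :: "(real^3) set"
  assumes D1: "bounded_domain D1" and D2: "bounded_domain D2" and dist: "0 < setdist D1 D2"
    and \<Phi>: "eigenfunction (D1 \<union> D2) (K_diag D1 D2) \<rho> \<Phi>" "l2_norm (D1 \<union> D2) \<Phi> = 1"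
    and \<Phi>\<kappa>: "eigenfunction (D1 \<union> D2) (K_full D1 D2) \<rho>\<kappa> \<Phi>\<kappa>"
    and \<rho>: "\<rho> \<noteq> 0" "norm (\<rho>\<kappa> - \<rho>) / norm \<rho> \<le> 1 / 2"
  defines "\<delta> \<equiv> l2_norm (D1 \<union> D2) (\<lambda>x. \<Phi>\<kappa> x - \<Phi> x)"
  shows "sup_norm (closure (D1 \<union> D2)) (\<lambda>x. \<Phi>\<kappa> x - \<Phi> x)
    \<le> 2 / norm \<rho> * (C0_diag D1 D2 * \<delta> + eps_inf D1 D2 + eps_inf D1 D2 * \<delta>
                     + norm (\<rho>\<kappa> - \<rho>) * (C0_diag D1 D2 / norm \<rho>))"
    (is "_ \<le> ?B")
proof -
  let ?D = "D1 \<union> D2"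
  let ?\<phi> = "\<lambda>x. \<Phi>\<kappa> x - \<Phi> x"
  have op: "open ?D" and ne: "?D \<noteq> {}" and bd: "bounded D1" "bounded D2"
    and sets: "D1 \<in> sets lebesgue" "D2 \<in> sets lebesgue"
    using D1 D2 by (auto simp: bounded_domain_def)
  have L2: "\<Phi> \<in> l2_space ?D" "\<Phi>\<kappa> \<in> l2_space ?D"
    using \<Phi> \<Phi>\<kappa> by (auto simp: eigenfunction_def)
  then have L2\<phi>: "?\<phi> \<in> l2_space ?D" by (rule l2_space_diff[rotated])
  have half: "norm \<rho> / 2 \<le> norm \<rho>\<kappa>"
    using \<rho> norm_triangle_ineq2[of \<rho> "\<rho> - \<rho>\<kappa>"] by (simp add: field_simps norm_minus_commute)
  have pointwise: "norm (?\<phi> x) \<le> ?B"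
    if x: "x \<in> ?D" and e: "K_diag D1 D2 \<Phi> x = \<rho> * \<Phi> x" "K_full D1 D2 \<Phi>\<kappa> x = \<rho>\<kappa> * \<Phi>\<kappa> x" for x
  proof -
    note diag = norm_K_diag_le[OF bd sets _ x] and off = norm_K_off_le[OF bd sets _ x]
    have "norm \<rho> * norm (\<Phi> x) \<le> C0_diag D1 D2"
      using diag[OF L2(1)] e(1) \<Phi>(2) by (simp add: norm_mult)
    then have \<Phi>x: "norm (\<Phi> x) \<le> C0_diag D1 D2 / norm \<rho>"
      using \<rho> by (simp add: field_simps)
    have id: "\<rho>\<kappa> * ?\<phi> x = K_diag D1 D2 ?\<phi> x + K_off D1 D2 \<Phi> x + K_off D1 D2 ?\<phi> x
        - (\<rho>\<kappa> - \<rho>) * \<Phi> x"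
    proof -
      have "\<rho>\<kappa> * \<Phi>\<kappa> x = K_diag D1 D2 \<Phi>\<kappa> x + K_off D1 D2 \<Phi>\<kappa> x"
        using e(2) K_full_eq[OF bd sets dist L2(2) x] by simp
      then show ?thesis
        unfolding K_diag_diff[OF bd sets L2(2,1)] K_off_diff[OF bd sets L2(2,1)] e(1)
        by (simp add: algebra_simps)
    qed
    have "norm \<rho> / 2 * norm (?\<phi> x) \<le> norm (\<rho>\<kappa> * ?\<phi> x)"
      unfolding norm_mult using half by (rule mult_right_mono) simp
    also have "\<dots> \<le> norm (K_diag D1 D2 ?\<phi> x) + norm (K_off D1 D2 \<Phi> x) + norm (K_off D1 D2 ?\<phi> x)
        + norm ((\<rho>\<kappa> - \<rho>) * \<Phi> x)"
      unfolding id
      by (intro order_trans[OF norm_triangle_ineq4] add_right_mono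
          order_trans[OF norm_triangle_ineq]) simp
    also have "\<dots> \<le> C0_diag D1 D2 * \<delta> + eps_inf D1 D2 + eps_inf D1 D2 * \<delta>
        + norm (\<rho>\<kappa> - \<rho>) * (C0_diag D1 D2 / norm \<rho>)"
      unfolding norm_mult \<delta>_def
      using diag[OF L2\<phi>] off[OF L2(1)] off[OF L2\<phi>] mult_left_mono[OF \<Phi>x norm_ge_zero[of "\<rho>\<kappa> - \<rho>"]] \<Phi>(2)
      by simp
    finally show ?thesis using \<rho> by (simp add: field_simps)
  qed
  have "AE x in lebesgue_on ?D. x \<in> ?D"
    using AE_space[of "lebesgue_on ?D"] by simp
  moreover have "AE x in lebesgue_on ?D. K_diag D1 D2 \<Phi> x = \<rho> * \<Phi> x"
    "AE x in lebesgue_on ?D. K_full D1 D2 \<Phi>\<kappa> x = \<rho>\<kappa> * \<Phi>\<kappa> x"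
    using \<Phi>(1) \<Phi>\<kappa> by (auto simp: eigenfunction_def l2_eq_def)
  ultimately have ae: "AE x in lebesgue_on ?D. norm (?\<phi> x) \<le> ?B"
    by eventually_elim (rule pointwise)
  have cont: "continuous_on (closure ?D) ?\<phi>"
    using \<Phi>(1) \<Phi>\<kappa> by (intro continuous_on_diff) (auto simp: eigenfunction_def)
  show ?thesis
    unfolding sup_norm_def
  proof (rule cSUP_least)
    show "closure ?D \<noteq> {}" using ne by simp
  qed (rule AE_norm_le_imp_closure[OF op cont ae])
qed

theorem corollary4p1p2:
  shows "\<exists>c>0. \<forall>C1>0. \<forall>C2>0. \<exists>C>0.
    \<forall>(D1 :: (real^3) set) (D2 :: (real^3) set) (\<rho> :: complex) (\<Phi> :: field) (\<rho>\<kappa> :: complex) (\<Phi>\<kappa> :: field).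
      bounded_domain D1 \<longrightarrow> bounded_domain D2 \<longrightarrow> setdist D1 D2 > 0 \<longrightarrow>
      eigenfunction (D1 \<union> D2) (K_diag D1 D2) \<rho> \<Phi> \<longrightarrow>
      l2_norm (D1 \<union> D2) \<Phi> = 1 \<longrightarrow>
      simple_eigenvalue (D1 \<union> D2) (K_diag D1 D2) \<rho> \<longrightarrow>
      \<rho> isolated_in l2_spectrum (D1 \<union> D2) (K_diag D1 D2) \<longrightarrow>
      spectral_gap D1 D2 \<rho> > 0 \<longrightarrow>
      eps2 D1 D2 \<le> c * spectral_gap D1 D2 \<rho> \<longrightarrow>
      coupled_eigenpair D1 D2 \<rho> \<Phi> C1 \<rho>\<kappa> \<Phi>\<kappa> \<longrightarrow>
      \<rho> \<noteq> 0 \<longrightarrow>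
      norm (\<rho>\<kappa> - \<rho>) / norm \<rho> \<le> 1 / 2 \<longrightarrow>
      norm (\<rho>\<kappa> - \<rho>) \<le> C2 * ((eps2 D1 D2)\<^sup>2 / spectral_gap D1 D2 \<rho>) \<longrightarrow>
      sup_norm (closure (D1 \<union> D2)) (\<lambda>x. \<Phi>\<kappa> x - \<Phi> x) \<le>
        C * (C0_diag D1 D2 / norm \<rho> * (eps2 D1 D2 / spectral_gap D1 D2 \<rho>)
             + eps_inf D1 D2 / norm \<rho>
             + eps_inf D1 D2 / norm \<rho> * (eps2 D1 D2 / spectral_gap D1 D2 \<rho>)
             + C0_diag D1 D2 / (norm \<rho>)\<^sup>2 * ((eps2 D1 D2)\<^sup>2 / spectral_gap D1 D2 \<rho>))"
    (is "\<exists>c>0. \<forall>C1>0. \<forall>C2>0. \<exists>C>0. ?P c C1 C2 C")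
proof (rule exI[of _ "1::real"], intro conjI allI impI)
  fix C1 C2 :: real
  assume C: "0 < C1" "0 < C2"
  \<comment> \<open>The factor 2 is the loss from \<open>\<bar>\<rho>\<kappa>\<bar> \<ge> \<bar>\<rho>\<bar> / 2\<close>; the sum dominates the coefficient of every term.\<close>
  define C where "C = 2 * (1 + C1 + C2)"
  show "\<exists>C>0. ?P 1 C1 C2 C"
  proof (intro exI[of _ C] conjI allI impI)
    show "0 < C" using C by (simp add: C_def)
    fix D1 D2 :: "(real^3) set" and \<rho> \<rho>\<kappa> :: complex and \<Phi> \<Phi>\<kappa> :: field
    assume D1: "bounded_domain D1" and D2: "bounded_domain D2" and dist: "setdist D1 D2 > 0"
      and \<Phi>: "eigenfunction (D1 \<union> D2) (K_diag D1 D2) \<rho> \<Phi>" "l2_norm (D1 \<union> D2) \<Phi> = 1"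
      and gap: "spectral_gap D1 D2 \<rho> > 0"
      and pair: "coupled_eigenpair D1 D2 \<rho> \<Phi> C1 \<rho>\<kappa> \<Phi>\<kappa>"
      and \<rho>: "\<rho> \<noteq> 0" "norm (\<rho>\<kappa> - \<rho>) / norm \<rho> \<le> 1 / 2"
      and \<delta>\<rho>: "norm (\<rho>\<kappa> - \<rho>) \<le> C2 * ((eps2 D1 D2)\<^sup>2 / spectral_gap D1 D2 \<rho>)"
    let ?D = "D1 \<union> D2"
    define K where "K = C0_diag D1 D2"
    define \<epsilon> where "\<epsilon> = eps_inf D1 D2"
    define q where "q = eps2 D1 D2 / spectral_gap D1 D2 \<rho>"
    define s where "s = (eps2 D1 D2)\<^sup>2 / spectral_gap D1 D2 \<rho>"
    define \<delta> where "\<delta> = l2_norm ?D (\<lambda>x. \<Phi>\<kappa> x - \<Phi> x)"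
    define r where "r = norm \<rho>"
    have r: "0 < r" using \<rho> by (simp add: r_def)
    have \<Phi>\<kappa>: "eigenfunction ?D (K_full D1 D2) \<rho>\<kappa> \<Phi>\<kappa>" and \<delta>: "\<delta> \<le> C1 * q"
      using pair by (auto simp: coupled_eigenpair_def Let_def \<delta>_def q_def)
    \<comment> \<open>The sign of \<open>eps2\<close>, a supremum of reals, is read off from the norm that it bounds.\<close>
    have "0 \<le> C1 * q" using \<delta> l2_norm_nonneg[of ?D] by (force simp: \<delta>_def intro: order_trans)
    then have q: "0 \<le> q" using C by (simp add: zero_le_mult_iff)
    have s: "0 \<le> s" using gap by (simp add: s_def)
    obtain x where x: "x \<in> ?D" using D1 by (auto simp: bounded_domain_def)
    have bd: "bounded D1" "bounded D2" "D1 \<in> sets lebesgue" "D2 \<in> sets lebesgue"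
      using D1 D2 by (auto simp: bounded_domain_def)
    have "\<Phi> \<in> l2_space ?D" using \<Phi>(1) by (simp add: eigenfunction_def)
    then have K: "0 \<le> K" and \<epsilon>: "0 \<le> \<epsilon>"
      using norm_K_diag_le[OF bd _ x, of \<Phi>] norm_K_off_le[OF bd _ x, of \<Phi>] \<Phi>(2)
      by (auto simp: K_def \<epsilon>_def intro: order_trans[OF norm_ge_zero])
    have "sup_norm (closure ?D) (\<lambda>x. \<Phi>\<kappa> x - \<Phi> x)
        \<le> 2 / r * (K * \<delta> + \<epsilon> + \<epsilon> * \<delta> + norm (\<rho>\<kappa> - \<rho>) * (K / r))"
      using eigenfunction_perturbation_sup_norm[OF D1 D2 dist \<Phi> \<Phi>\<kappa> \<rho>]
      by (simp add: K_def \<epsilon>_def \<delta>_def r_def)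
    also have "\<dots> \<le> 2 / r * ((1 + C1 + C2) * (K * q + \<epsilon> + \<epsilon> * q + K / r * s))"
    proof (rule mult_left_mono)
      have "K * \<delta> \<le> K * (C1 * q)" "\<epsilon> * \<delta> \<le> \<epsilon> * (C1 * q)"
        using \<delta> K \<epsilon> by (auto intro: mult_left_mono)
      moreover have "norm (\<rho>\<kappa> - \<rho>) * (K / r) \<le> C2 * s * (K / r)"
        using \<delta>\<rho> K r by (intro mult_right_mono) (auto simp: s_def)
      ultimately have "K * \<delta> + \<epsilon> + \<epsilon> * \<delta> + norm (\<rho>\<kappa> - \<rho>) * (K / r)
          \<le> C1 * (K * q) + 1 * \<epsilon> + C1 * (\<epsilon> * q) + C2 * (K / r * s)"
        by (simp add: algebra_simps)
      also have "\<dots> \<le> (1 + C1 + C2) * (K * q) + (1 + C1 + C2) * \<epsilon> + (1 + C1 + C2) * (\<epsilon> * q)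
          + (1 + C1 + C2) * (K / r * s)"
        using C K \<epsilon> q s r by (intro add_mono mult_right_mono) auto
      finally show "K * \<delta> + \<epsilon> + \<epsilon> * \<delta> + norm (\<rho>\<kappa> - \<rho>) * (K / r)
          \<le> (1 + C1 + C2) * (K * q + \<epsilon> + \<epsilon> * q + K / r * s)"
        by (simp only: distrib_left)
    qed (use r in simp)
    also have "\<dots> = C * (K / r * q + \<epsilon> / r + \<epsilon> / r * q + K / r\<^sup>2 * s)"
      using r by (simp add: C_def field_simps power2_eq_square)
    finally show "sup_norm (closure ?D) (\<lambda>x. \<Phi>\<kappa> x - \<Phi> x) \<le>
        C * (C0_diag D1 D2 / norm \<rho> * (eps2 D1 D2 / spectral_gap D1 D2 \<rho>)
             + eps_inf D1 D2 / norm \<rho>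
             + eps_inf D1 D2 / norm \<rho> * (eps2 D1 D2 / spectral_gap D1 D2 \<rho>)
             + C0_diag D1 D2 / (norm \<rho>)\<^sup>2 * ((eps2 D1 D2)\<^sup>2 / spectral_gap D1 D2 \<rho>))"
      by (simp only: K_def \<epsilon>_def q_def s_def r_def)
  qed
qed simp

end
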